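(* Let $\mathcal{H}$ be a complex Hilbert space and let $x,y,z\in\mathcal{H}$ be any nonzero vectors. Then \[ \begin{aligned} \psi_{x,y}&\le \cos^{-1}\Big(\cos\psi_{x,y}+\big|\cos\psi_{x,y}-\cos\psi_{x,z}\cos\psi_{z,y}\big|-\sin\psi_{x,z}\sin\psi_{z,y}\Big)\\ &\le \psi_{x,z}+\psi_{z,y}. \end{aligned} \]
   Context: For nonzero vectors $x,y$ in a complex Hilbert space with inner product $\langle\cdot,\cdot\rangle$ and norm $\|\cdot\|$, the angle $\psi_{x,y}$ is defined by $\cos\psi_{x,y}=\dfrac{|\langle x,y\rangle|}{\|x\|\,\|y\|}$ with $0\le\psi_{x,y}\le\frac{\pi}{2}$. Here $\cos^{-1}:[-1,1]\to[0,\pi]$ is the inverse cosine. *)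

theory Defs
  imports "HOL-Analysis.Analysis"
begin

class complex_vector = real_vector +
  fixes scaleC :: "complex \<Rightarrow> 'a \<Rightarrow> 'a"  (infixr "*\<^sub>C" 75)
  assumes scaleC_add_right: "a *\<^sub>C (x + y) = a *\<^sub>C x + a *\<^sub>C y"
    and scaleC_add_left: "(a + b) *\<^sub>C x = a *\<^sub>C x + b *\<^sub>C x"
    and scaleC_scaleC: "a *\<^sub>C b *\<^sub>C x = (a * b) *\<^sub>C x"
    and scaleC_one: "1 *\<^sub>C x = x"
    and scaleR_scaleC: "r *\<^sub>R x = complex_of_real r *\<^sub>C x"

text \<open>The inner product is linear in the first and conjugate-linear in the second argument. The norm
  axioms of \<^class>\<open>real_normed_vector\<close> are implied by \<open>norm_eq_sqrt_cinner\<close>; that class is a superclass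
  because it makes the metric and the topology those of the norm.\<close>

class complex_inner = complex_vector + real_normed_vector +
  fixes cinner :: "'a \<Rightarrow> 'a \<Rightarrow> complex"
  assumes cinner_commute: "cinner x y = cnj (cinner y x)"
    and cinner_add_left: "cinner (x + y) z = cinner x z + cinner y z"
    and cinner_scaleC_left: "cinner (a *\<^sub>C x) y = a * cinner x y"
    and cinner_ge_zero: "0 \<le> Re (cinner x x)"
    and cinner_eq_zero_iff: "cinner x x = 0 \<longleftrightarrow> x = 0"
    and norm_eq_sqrt_cinner: "norm x = sqrt (Re (cinner x x))"

lemma cinner_add_right:
  fixes x y z :: "'a::complex_inner"
  shows "cinner x (y + z) = cinner x y + cinner x z"
  by (metis cinner_add_left cinner_commute complex_cnj_add)

lemma cinner_scaleC_right:
  fixes x y :: "'a::complex_inner"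
  shows "cinner x (a *\<^sub>C y) = cnj a * cinner x y"
  by (metis cinner_scaleC_left cinner_commute complex_cnj_mult)

lemma cinner_self:
  fixes x :: "'a::complex_inner"
  shows "cinner x x = complex_of_real ((norm x)\<^sup>2)"
proof -
  have "Im (cinner x x) = 0"
    using arg_cong[OF cinner_commute[of x x], of Im] by simp
  then show ?thesis
    by (simp add: complex_eq_iff norm_eq_sqrt_cinner cinner_ge_zero)
qed

lemma cinner_Cauchy_Schwarz:
  fixes x y :: "'a::complex_inner"
  shows "cmod (cinner x y) \<le> norm x * norm y"
proof (cases "y = 0")
  case True
  have "cinner x 0 = 0"
    using cinner_add_right[of x 0 0] by simp
  then show ?thesis
    using True by simp
next
  case False
  define n where "n = (norm y)\<^sup>2"
  define c where "c = - (cinner x y / complex_of_real n)"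
  have n: "n > 0"
    using False by (simp add: n_def)
  have "cinner (x + c *\<^sub>C y) (x + c *\<^sub>C y)
      = cinner x x + cnj c * cinner x y + c * cnj (cinner x y) + c * (cnj c * cinner y y)"
    by (simp add: cinner_add_left cinner_add_right cinner_scaleC_left cinner_scaleC_right
        cinner_commute[of y x] algebra_simps)
  also have "\<dots> = complex_of_real ((norm x)\<^sup>2) - cinner x y * cnj (cinner x y) / complex_of_real n"
    using n by (simp add: cinner_self c_def n_def[symmetric] field_simps)
  also have "\<dots> = complex_of_real ((norm x)\<^sup>2 - (cmod (cinner x y))\<^sup>2 / n)"
    by (simp flip: complex_norm_square)
  finally have "0 \<le> (norm x)\<^sup>2 - (cmod (cinner x y))\<^sup>2 / n"
    using cinner_ge_zero[of "x + c *\<^sub>C y"] by simp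
  then have "(cmod (cinner x y))\<^sup>2 \<le> (norm x * norm y)\<^sup>2"
    using n by (simp add: n_def field_simps power_mult_distrib)
  then show ?thesis
    by (rule power2_le_imp_le) simp
qed

class chilbert_space = complex_inner + complete_space

instantiation complex :: chilbert_space
begin

definition scaleC_complex :: "complex \<Rightarrow> complex \<Rightarrow> complex"
  where "scaleC_complex a x = a * x"

definition cinner_complex :: "complex \<Rightarrow> complex \<Rightarrow> complex"
  where "cinner_complex x y = x * cnj y"

instance
  by standard
    (simp_all add: scaleC_complex_def cinner_complex_def algebra_simps scaleR_conv_of_real
      cmod_def power2_eq_square)

end

text \<open>Meaningful for nonzero vectors only, where it exists and is unique by \<open>vangle_eq_iff\<close>.\<close>

definition vangle :: "'a::complex_inner \<Rightarrow> 'a \<Rightarrow> real"  ("\<psi>")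
  where "\<psi> x y = (THE t. 0 \<le> t \<and> t \<le> pi / 2 \<and> cos t = cmod (cinner x y) / (norm x * norm y))"

lemma vangle_eq_iff:
  fixes x y :: "'a::complex_inner"
  assumes "x \<noteq> 0" "y \<noteq> 0"
  shows "\<psi> x y = t \<longleftrightarrow> 0 \<le> t \<and> t \<le> pi / 2 \<and> cos t = cmod (cinner x y) / (norm x * norm y)"
proof -
  define r where "r = cmod (cinner x y) / (norm x * norm y)"
  have r: "0 \<le> r" "r \<le> 1"
    using assms cinner_Cauchy_Schwarz[of x y] by (simp_all add: r_def divide_le_eq)
  have ex1: "\<exists>!t. 0 \<le> t \<and> t \<le> pi / 2 \<and> cos t = r"
  proof (rule ex_ex1I)
    have "0 \<le> arccos r" "cos (arccos r) = r"
      using r by (simp_all add: arccos_lbound)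
    moreover have "arccos r \<le> pi / 2"
      using r by (rule arccos_le_pi2)
    ultimately show "\<exists>t. 0 \<le> t \<and> t \<le> pi / 2 \<and> cos t = r"
      by blast
  next
    fix s t
    assume "0 \<le> s \<and> s \<le> pi / 2 \<and> cos s = r" "0 \<le> t \<and> t \<le> pi / 2 \<and> cos t = r"
    then show "s = t"
      using cos_inj_pi[of s t] pi_gt_zero by auto
  qed
  show ?thesis
    unfolding vangle_def r_def[symmetric] by (metis (no_types, lifting) theI'[OF ex1] the1_equality[OF ex1])
qed

end

theory Submission
  imports Defs
begin

text \<open>Remove from \<open>x\<close> and \<open>y\<close> their components along \<open>z\<close>. The residuals have norms
  \<open>\<parallel>x\<parallel> sin \<psi>\<^sub>x\<^sub>z\<close> and \<open>\<parallel>y\<parallel> sin \<psi>\<^sub>z\<^sub>y\<close>, and their inner product is that of \<open>x\<close> and \<open>y\<close> minus that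
  of the removed components. Cauchy--Schwarz for the residuals, followed by the reverse triangle
  inequality for the modulus, gives
  \<open>\<bar>cos \<psi>\<^sub>x\<^sub>y - cos \<psi>\<^sub>x\<^sub>z cos \<psi>\<^sub>z\<^sub>y\<bar> \<le> sin \<psi>\<^sub>x\<^sub>z sin \<psi>\<^sub>z\<^sub>y\<close>
  (lemma \<open>abs_cos_vangle_diff_le\<close>). Write \<open>c\<close> for the argument of the inverse cosine. This
  inequality says precisely that \<open>c \<le> cos \<psi>\<^sub>x\<^sub>y\<close>, while \<open>\<bar>t\<bar> \<ge> - t\<close> and the addition formula give
  \<open>c \<ge> cos (\<psi>\<^sub>x\<^sub>z + \<psi>\<^sub>z\<^sub>y)\<close>. The theorem follows because \<open>arccos\<close>
  is decreasing and both \<open>\<psi>\<^sub>x\<^sub>y\<close> and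
  \<open>\<psi>\<^sub>x\<^sub>z + \<psi>\<^sub>z\<^sub>y\<close> lie in \<open>[0, \<pi>]\<close>.\<close>

lemma vangle_bounds:
  fixes x y :: "'a::complex_inner"
  assumes "x \<noteq> 0" "y \<noteq> 0"
  shows "0 \<le> \<psi> x y" "\<psi> x y \<le> pi / 2"
  using vangle_eq_iff[OF assms, of "\<psi> x y"] by simp_all

lemma cos_vangle:
  fixes x y :: "'a::complex_inner"
  assumes "x \<noteq> 0" "y \<noteq> 0"
  shows "cos (\<psi> x y) = cmod (cinner x y) / (norm x * norm y)"
  using vangle_eq_iff[OF assms, of "\<psi> x y"] by simp

lemma cmod_cinner_commute:
  fixes x y :: "'a::complex_inner"
  shows "cmod (cinner x y) = cmod (cinner y x)"
  by (metis cinner_commute complex_mod_cnj)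

lemma vangle_commute:
  fixes x y :: "'a::complex_inner"
  shows "\<psi> x y = \<psi> y x"
  by (simp add: vangle_def cmod_cinner_commute[of x y] mult.commute)

definition residual :: "'a::complex_inner \<Rightarrow> 'a \<Rightarrow> 'a"
  where "residual z x = x + (- (cinner x z / complex_of_real ((norm z)\<^sup>2))) *\<^sub>C z"

lemma cinner_residual:
  fixes x y z :: "'a::complex_inner"
  assumes "z \<noteq> 0"
  shows "cinner (residual z x) (residual z y)
    = cinner x y - cinner x z * cinner z y / complex_of_real ((norm z)\<^sup>2)"
  using assms
  by (simp add: residual_def cinner_add_left cinner_add_right cinner_scaleC_left
      cinner_scaleC_right cinner_self cinner_commute[of z y] field_simps)

text \<open>Pythagoras: the component along \<open>z\<close> has norm \<open>\<parallel>x\<parallel> cos \<psi>\<^sub>x\<^sub>z\<close>, and sines of angles between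
  vectors are nonnegative.\<close>

lemma norm_residual:
  fixes x z :: "'a::complex_inner"
  assumes "x \<noteq> 0" "z \<noteq> 0"
  shows "norm (residual z x) = norm x * sin (\<psi> x z)"
proof (rule power2_eq_imp_eq)
  have "complex_of_real ((norm (residual z x))\<^sup>2)
      = complex_of_real ((norm x)\<^sup>2 - (cmod (cinner x z))\<^sup>2 / (norm z)\<^sup>2)"
    using cinner_residual[OF assms(2), of x x] cinner_commute[of z x]
      complex_norm_square[of "cinner x z"]
    by (simp add: cinner_self)
  then have "(norm (residual z x))\<^sup>2 = (norm x)\<^sup>2 - (cmod (cinner x z))\<^sup>2 / (norm z)\<^sup>2"
    by (simp only: of_real_eq_iff)
  also have "\<dots> = (norm x)\<^sup>2 * (1 - (cos (\<psi> x z))\<^sup>2)"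
    using assms by (simp add: cos_vangle field_simps)
  also have "\<dots> = (norm x * sin (\<psi> x z))\<^sup>2"
    by (simp add: power_mult_distrib sin_squared_eq)
  finally show "(norm (residual z x))\<^sup>2 = (norm x * sin (\<psi> x z))\<^sup>2" .
  show "0 \<le> norm x * sin (\<psi> x z)"
    using vangle_bounds[OF assms] by (simp add: sin_ge_zero)
qed simp

lemma abs_cos_vangle_diff_le:
  fixes x y z :: "'a::complex_inner"
  assumes "x \<noteq> 0" "y \<noteq> 0" "z \<noteq> 0"
  shows "\<bar>cos (\<psi> x y) - cos (\<psi> x z) * cos (\<psi> z y)\<bar> \<le> sin (\<psi> x z) * sin (\<psi> z y)"
proof -
  let ?w = "cinner x z * cinner z y / complex_of_real ((norm z)\<^sup>2)"
  have "\<bar>cmod (cinner x y) - cmod ?w\<bar> \<le> cmod (cinner x y - ?w)"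
    by (rule norm_triangle_ineq3)
  also have "\<dots> \<le> norm (residual z x) * norm (residual z y)"
    using cinner_Cauchy_Schwarz[of "residual z x" "residual z y"] assms
    by (simp add: cinner_residual)
  also have "\<dots> = (norm x * norm y) * (sin (\<psi> x z) * sin (\<psi> z y))"
    using assms by (simp add: norm_residual vangle_commute[of z y])
  finally have le: "\<bar>cmod (cinner x y) - cmod ?w\<bar>
      \<le> (norm x * norm y) * (sin (\<psi> x z) * sin (\<psi> z y))" .
  have "cmod (cinner x y) - cmod ?w
      = (norm x * norm y) * (cos (\<psi> x y) - cos (\<psi> x z) * cos (\<psi> z y))"
    using assms
    by (simp add: cos_vangle norm_mult norm_divide norm_power power2_eq_square field_simps)
  then have "(norm x * norm y) * \<bar>cos (\<psi> x y) - cos (\<psi> x z) * cos (\<psi> z y)\<bar>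
      \<le> (norm x * norm y) * (sin (\<psi> x z) * sin (\<psi> z y))"
    using le by (simp add: abs_mult)
  then show ?thesis
    using assms by (simp add: mult_le_cancel_left_pos)
qed

theorem corollary2p1:
  fixes x y z :: "'a::chilbert_space"
  assumes "x \<noteq> 0" and "y \<noteq> 0" and "z \<noteq> 0"
  shows
    "let c = cos (\<psi> x y) + \<bar>cos (\<psi> x y) - cos (\<psi> x z) * cos (\<psi> z y)\<bar> - sin (\<psi> x z) * sin (\<psi> z y)
     in c \<in> {-1..1} \<and> \<psi> x y \<le> arccos c \<and> arccos c \<le> \<psi> x z + \<psi> z y"
proof -
  define c where
    "c = cos (\<psi> x y) + \<bar>cos (\<psi> x y) - cos (\<psi> x z) * cos (\<psi> z y)\<bar> - sin (\<psi> x z) * sin (\<psi> z y)"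
  note bounds = vangle_bounds[OF assms(1,2)] vangle_bounds[OF assms(1,3)]
    vangle_bounds[OF assms(3,2)]
  have upper: "c \<le> cos (\<psi> x y)"
    using abs_cos_vangle_diff_le[OF assms] by (simp add: c_def)
  have lower: "cos (\<psi> x z + \<psi> z y) \<le> c"
    by (simp add: c_def cos_add)
  have range: "-1 \<le> c" "c \<le> 1"
    using lower upper cos_ge_minus_one[of "\<psi> x z + \<psi> z y"] cos_le_one[of "\<psi> x y"]
    by linarith+
  have "\<psi> x y = arccos (cos (\<psi> x y))"
    using bounds by (simp add: arccos_cos)
  also have "\<dots> \<le> arccos c"
    using upper range by (intro arccos_le_arccos) simp_all
  finally have left: "\<psi> x y \<le> arccos c" .
  have "arccos c \<le> arccos (cos (\<psi> x z + \<psi> z y))"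
    using lower range by (intro arccos_le_arccos) simp_all
  also have "\<dots> = \<psi> x z + \<psi> z y"
    using bounds by (simp add: arccos_cos)
  finally have "arccos c \<le> \<psi> x z + \<psi> z y" .
  with left range show ?thesis
    by (simp add: Let_def flip: c_def)
qed

end
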